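(* Let $s\in\mathbb{C}^N$ be a complex power injection vector with $\xi(s)<0.25$. Let $$\mathcal{D}' := \left\{v\in\mathbb{C}^N:\ |v_i-w_i|\le \frac{\left(1-\sqrt{1-4\xi(s)}\right)|w_i|}{2}\ \text{ for all } i=1,\dots,N\right\}.$$ Then there exists a unique $v\in\mathcal{D}'$ such that $(v,s)$ is a solution of the load-flow equation, i.e. $$v = w + Y_{LL}^{-1}\,\mathrm{diag}(\overline{v})^{-1}\,\overline{s}.$$ Moreover, for every starting point $v^{(0)}\in\mathcal{D}'$, the iteration $$v^{(k+1)} = w + Y_{LL}^{-1}\,\mathrm{diag}(\overline{v^{(k)}})^{-1}\,\overline{s}$$ converges to this solution $v$.
   Context: Consider a network with one slack bus (index $0$, with complex voltage fixed to $1$) and $N$ $PQ$ buses (indices $1,\dots,N$). Its nodal admittance matrix is a complex $(N+1)\times(N+1)$ matrix partitioned as $$Y=\begin{bmatrix} Y_{00} & Y_{0L}\\ Y_{L0} & Y_{LL}\end{bmatrix},$$ with $Y_{00}$ a scalar, $Y_{0L}$ a $1\times N$ row, $Y_{L0}$ an $N\times 1$ column and $Y_{LL}$ an $N\times N$ matrix. Standing assumptions: $Y_{LL}$ is invertible, and the zero-load voltage $w := -Y_{LL}^{-1}Y_{L0}\in\mathbb{C}^N$ has all entries nonzero. Put $W := \mathrm{diag}(w)$. Bars denote (entrywise) complex conjugation. For $s\in\mathbb{C}^N$ define $$\xi(s) := \left\| W^{-1}Y_{LL}^{-1}\overline{W}^{-1}\mathrm{diag}(\overline{s})\right\|_\infty,$$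 where for a complex matrix $A$, $\|A\|_\infty := \max_i\sum_j|A_{ij}|$. The load-flow equation for nodal voltages $v\in\mathbb{C}^N$ (with all $v_j\ne 0$) and nodal power injections $s\in\mathbb{C}^N$ is $v = w + Y_{LL}^{-1}\mathrm{diag}(\overline{v})^{-1}\overline{s}$. *)

theory Defs
  imports "HOL-Analysis.Analysis"
begin

(* The PQ buses are the elements of a finite type 'n (hence N = CARD('n)); all N + 1 buses form
   'n option, where None is the slack bus. *)

definition cnj_vec :: "complex ^ 'n \<Rightarrow> complex ^ 'n" where
  "cnj_vec x = (\<chi> i. cnj (x $ i))"

definition cnj_mat :: "complex ^ 'n ^ 'm \<Rightarrow> complex ^ 'n ^ 'm" where
  "cnj_mat A = (\<chi> i j. cnj (A $ i $ j))"

definition diag_mat :: "complex ^ 'n \<Rightarrow> complex ^ 'n ^ 'n" where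
  "diag_mat x = (\<chi> i j. if i = j then x $ i else 0)"

definition inf_norm :: "complex ^ 'n ^ 'm \<Rightarrow> real" where
  "inf_norm A = Max (range (\<lambda>i. \<Sum>j\<in>UNIV. cmod (A $ i $ j)))"

definition Y_LL :: "complex ^ ('n::finite option) ^ ('n option) \<Rightarrow> complex ^ 'n ^ 'n" where
  "Y_LL Y = (\<chi> i j. Y $ Some i $ Some j)"

definition Y_L0 :: "complex ^ ('n::finite option) ^ ('n option) \<Rightarrow> complex ^ 'n" where
  "Y_L0 Y = (\<chi> i. Y $ Some i $ None)"

definition zero_load_voltage :: "complex ^ ('n::finite option) ^ ('n option) \<Rightarrow> complex ^ 'n" where
  "zero_load_voltage Y = - (matrix_inv (Y_LL Y) *v Y_L0 Y)"

definition xi :: "complex ^ ('n::finite option) ^ ('n option) \<Rightarrow> complex ^ 'n \<Rightarrow> real" where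
  "xi Y s = (let W = diag_mat (zero_load_voltage Y) in
     inf_norm (matrix_inv W ** matrix_inv (Y_LL Y) ** matrix_inv (cnj_mat W)
       ** diag_mat (cnj_vec s)))"

(* Meaningful only if all entries of v are nonzero: matrix_inv is unspecified on
   singular matrices. *)
definition load_flow_map ::
  "complex ^ ('n::finite option) ^ ('n option) \<Rightarrow> complex ^ 'n \<Rightarrow> complex ^ 'n \<Rightarrow> complex ^ 'n" where
  "load_flow_map Y s v = zero_load_voltage Y
     + (matrix_inv (Y_LL Y) ** matrix_inv (diag_mat (cnj_vec v))) *v cnj_vec s"

definition load_flow_solution ::
  "complex ^ ('n::finite option) ^ ('n option) \<Rightarrow> complex ^ 'n \<Rightarrow> complex ^ 'n \<Rightarrow> bool" where
  "load_flow_solution Y v s \<longleftrightarrow> (\<forall>j. v $ j \<noteq> 0) \<and> v = load_flow_map Y s v"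

definition voltage_region ::
  "complex ^ ('n::finite option) ^ ('n option) \<Rightarrow> complex ^ 'n \<Rightarrow> (complex ^ 'n) set" where
  "voltage_region Y s = {v. \<forall>i. cmod (v $ i - zero_load_voltage Y $ i)
     \<le> (1 - sqrt (1 - 4 * xi Y s)) * cmod (zero_load_voltage Y $ i) / 2}"

end

theory Submission
  imports Defs
begin

text \<open>In the normalized voltages \<open>v\<^sub>i / w\<^sub>i\<close> the region is the polydisc of radius
  \<open>r\<close> around 1, where \<open>r\<close> is the smaller root of \<open>r (1 - r) = \<xi>\<close> and \<open>r < 1/2\<close>. There
  the moduli are at least \<open>1 - r\<close>, so the load-flow map stays within \<open>\<xi> / (1 - r) = r\<close> of 1 and is
  a contraction of the maximum norm with constant \<open>\<xi> / (1 - r)\<^sup>2 = r / (1 - r) < 1\<close>.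
  As the region is compact and convex, Brouwer's theorem already yields a fixed point; the
  contraction property gives uniqueness and convergence.\<close>

section \<open>Inverses, diagonal matrices and the row-sum norm\<close>

lemma matrix_inv_unique:
  fixes A :: "'a::semiring_1 ^ 'n::finite ^ 'n"
  assumes "A ** B = mat 1" "B ** A = mat 1"
  shows "matrix_inv A = B"
proof -
  \<comment> \<open>\<open>matrix_inv\<close> is a Hilbert choice; the witness \<open>B\<close>
    guarantees that the chosen matrix is a two-sided inverse.\<close>
  have inv: "A ** matrix_inv A = mat 1 \<and> matrix_inv A ** A = mat 1"
    unfolding matrix_inv_def by (rule someI[of _ B]) (simp add: assms)
  have "matrix_inv A = matrix_inv A ** (A ** B)"
    by (simp add: assms)
  also have "\<dots> = B"
    by (simp add: matrix_mul_assoc inv)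
  finally show ?thesis .
qed

lemma matrix_inv_diag_mat:
  fixes x :: "complex ^ 'n::finite"
  assumes "\<forall>i. x $ i \<noteq> 0"
  shows "matrix_inv (diag_mat x) = diag_mat (\<chi> i. inverse (x $ i))"
proof (rule matrix_inv_unique)
  show "diag_mat x ** diag_mat (\<chi> i. inverse (x $ i)) = mat 1"
    "diag_mat (\<chi> i. inverse (x $ i)) ** diag_mat x = mat 1"
    using assms
    by (auto simp: vec_eq_iff matrix_matrix_mult_def diag_mat_def mat_def
        if_distrib[of "\<lambda>a. a * _"] cong: if_cong)
qed

lemma matrix_mult_diag_mat_nth [simp]:
  fixes A :: "complex ^ 'n::finite ^ 'm"
  shows "(A ** diag_mat x) $ i $ j = A $ i $ j * x $ j"
  by (simp add: matrix_matrix_mult_def diag_mat_def if_distrib[of "\<lambda>a. _ * a"] cong: if_cong)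

lemma diag_mat_matrix_mult_nth [simp]:
  fixes A :: "complex ^ 'm ^ 'n::finite"
  shows "(diag_mat x ** A) $ i $ j = x $ i * A $ i $ j"
  by (simp add: matrix_matrix_mult_def diag_mat_def if_distrib[of "\<lambda>a. a * _"] cong: if_cong)

lemma cnj_mat_diag_mat: "cnj_mat (diag_mat x) = diag_mat (cnj_vec x)"
  by (simp add: vec_eq_iff cnj_mat_def diag_mat_def cnj_vec_def)

lemma row_sum_le_inf_norm:
  fixes A :: "complex ^ 'n ^ 'm::finite"
  shows "(\<Sum>j\<in>UNIV. cmod (A $ i $ j)) \<le> inf_norm A"
  unfolding inf_norm_def by (rule Max_ge) auto

lemma inf_norm_nonneg:
  fixes A :: "complex ^ 'n ^ 'm::finite"
  shows "0 \<le> inf_norm A"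
  \<comment> \<open>\<open>undefined\<close> is merely some row index: any row sum lies between 0
    and the norm.\<close>
  by (rule order_trans[OF _ row_sum_le_inf_norm[of A undefined]]) (simp add: sum_nonneg)

lemma xi_nonneg: "0 \<le> xi Y s"
  by (simp add: xi_def Let_def inf_norm_nonneg)

section \<open>The load-flow map in coordinates, and \<open>xi\<close> as a bound on weighted row
  sums\<close>

lemma load_flow_map_nth:
  assumes "\<forall>j. v $ j \<noteq> 0"
  shows "load_flow_map Y s v $ i =
    zero_load_voltage Y $ i + (\<Sum>j\<in>UNIV. matrix_inv (Y_LL Y) $ i $ j * cnj (s $ j) / cnj (v $ j))"
proof -
  have "matrix_inv (diag_mat (cnj_vec v)) = diag_mat (\<chi> j. inverse (cnj_vec v $ j))"
    using assms by (intro matrix_inv_diag_mat) (simp add: cnj_vec_def)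
  then show ?thesis
    by (simp add: load_flow_map_def matrix_vector_mult_def cnj_vec_def field_simps)
qed

lemma load_flow_solution_fixed: "load_flow_solution Y v s \<Longrightarrow> v = load_flow_map Y s v"
  by (simp only: load_flow_solution_def)

text \<open>With \<open>Z = matrix_inv (Y_LL Y)\<close>, row \<open>i\<close> of the matrix inside
  \<open>xi\<close> has entries \<open>Z_ij cnj(s_j) / (w_i cnj(w_j))\<close>. Its absolute row sum,
  multiplied by \<open>|w_i|\<close>, is the left side.\<close>

lemma weighted_row_sum_le_xi:
  assumes "\<forall>j. zero_load_voltage Y $ j \<noteq> 0"
  shows "(\<Sum>j\<in>UNIV. cmod (matrix_inv (Y_LL Y) $ i $ j * cnj (s $ j)) / cmod (zero_load_voltage Y $ j))
    \<le> xi Y s * cmod (zero_load_voltage Y $ i)"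
proof -
  define w where "w = zero_load_voltage Y"
  define Z where "Z = matrix_inv (Y_LL Y)"
  have w: "w $ j \<noteq> 0" for j
    using assms by (simp add: w_def)
  have inv: "matrix_inv (diag_mat w) = diag_mat (\<chi> j. inverse (w $ j))"
    "matrix_inv (cnj_mat (diag_mat w)) = diag_mat (\<chi> j. inverse (cnj (w $ j)))"
    using w by (simp_all add: matrix_inv_diag_mat cnj_mat_diag_mat cnj_vec_def)
  have "(\<Sum>j\<in>UNIV. cmod (Z $ i $ j * cnj (s $ j)) / cmod (w $ j)) / cmod (w $ i)
      = (\<Sum>j\<in>UNIV. cmod ((matrix_inv (diag_mat w) ** Z ** matrix_inv (cnj_mat (diag_mat w))
          ** diag_mat (cnj_vec s)) $ i $ j))"
    unfolding inv sum_divide_distrib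
    by (rule sum.cong) (simp_all add: cnj_vec_def norm_mult norm_inverse divide_inverse mult_ac)
  also have "\<dots> \<le> xi Y s"
    unfolding xi_def Let_def w_def Z_def by (rule row_sum_le_inf_norm)
  finally show ?thesis
    using w by (simp add: w_def Z_def divide_le_eq)
qed

text \<open>\<open>1/a - 1/b = (b - a)/(a b)\<close>, and both moduli are at least
  \<open>m |w|\<close>. One factor \<open>|w|\<close> cancels, leaving exactly the weight that
  \<open>cmod_row_sum_le\<close> asks for.\<close>

lemma cmod_diff_inverse_le:
  fixes a b w :: complex
  assumes "m * cmod w \<le> cmod a" "m * cmod w \<le> cmod b" "0 < m" "w \<noteq> 0"
    and "cmod (a - b) \<le> d * cmod w"
  shows "cmod (inverse a - inverse b) \<le> d / m\<^sup>2 / cmod w"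
proof -
  have pos: "0 < m * cmod w"
    using assms by simp
  then have "0 < cmod a" "0 < cmod b"
    using assms(1,2) by linarith+
  then have "a \<noteq> 0" "b \<noteq> 0"
    by auto
  then have "cmod (inverse a - inverse b) = cmod (a - b) / (cmod a * cmod b)"
    by (simp add: inverse_diff_inverse norm_mult norm_inverse divide_inverse mult_ac)
  also have "\<dots> \<le> d * cmod w / ((m * cmod w) * (m * cmod w))"
    by (rule frac_le[OF order_trans[OF norm_ge_zero assms(5)] assms(5) mult_pos_pos[OF pos pos]])
      (rule mult_mono[OF assms(1,2) norm_ge_zero less_imp_le[OF pos]])
  also have "\<dots> = d / m\<^sup>2 / cmod w"
    using assms(4) by (simp add: power2_eq_square)
  finally show ?thesis .
qed

section \<open>Radius and geometry of the voltage region\<close>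

definition region_radius :: "complex ^ ('n::finite option) ^ ('n option) \<Rightarrow> complex ^ 'n \<Rightarrow> real" where
  "region_radius Y s = (1 - sqrt (1 - 4 * xi Y s)) / 2"

lemma region_radius:
  assumes "xi Y s < 1 / 4"
  shows "0 \<le> region_radius Y s" "region_radius Y s < 1 / 2"
    "region_radius Y s * (1 - region_radius Y s) = xi Y s"
proof -
  define q where "q = sqrt (1 - 4 * xi Y s)"
  \<comment> \<open>For \<open>r = (1 - q) / 2\<close> one has
    \<open>r (1 - r) = (1 - q^2) / 4\<close>. Strictness of the bound on \<open>xi\<close> gives
    \<open>0 < q\<close>, hence \<open>r < 1/2\<close>; \<open>xi_nonneg\<close> gives
    \<open>q <= 1\<close>, hence \<open>0 <= r\<close>.\<close>
  have "0 < q" "q \<le> 1" "q\<^sup>2 = 1 - 4 * xi Y s"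
    using assms xi_nonneg[of Y s] by (simp_all add: q_def)
  then show "0 \<le> region_radius Y s" "region_radius Y s < 1 / 2"
    "region_radius Y s * (1 - region_radius Y s) = xi Y s"
    unfolding region_radius_def q_def[symmetric] by (auto simp: field_simps power2_eq_square)
qed

lemma mem_voltage_region_iff:
  "v \<in> voltage_region Y s \<longleftrightarrow>
    (\<forall>i. cmod (v $ i - zero_load_voltage Y $ i) \<le> region_radius Y s * cmod (zero_load_voltage Y $ i))"
  by (simp add: voltage_region_def region_radius_def)

lemma compact_voltage_region: "compact (voltage_region Y s)"
proof -
  have "closed (voltage_region Y s)"
    unfolding voltage_region_def
    by (intro closed_Collect_all closed_Collect_le continuous_intros)
  moreover have "bounded (voltage_region Y s)"
  proof (rule boundedI)
    fix v assume "v \<in> voltage_region Y s"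
    then have "cmod (v $ i) \<le> region_radius Y s * cmod (zero_load_voltage Y $ i)
        + cmod (zero_load_voltage Y $ i)" for i
      unfolding mem_voltage_region_iff
      using norm_triangle_sub[of "v $ i" "zero_load_voltage Y $ i"] by (smt (verit))
    then have "(\<Sum>i\<in>UNIV. cmod (v $ i)) \<le> (\<Sum>i\<in>UNIV. region_radius Y s * cmod (zero_load_voltage Y $ i)
        + cmod (zero_load_voltage Y $ i))"
      by (rule sum_mono)
    \<comment> \<open>The norm of the vector type is Euclidean, so it is at most the sum of the
      moduli of the entries.\<close>
    then show "norm v \<le> (\<Sum>i\<in>UNIV. region_radius Y s * cmod (zero_load_voltage Y $ i)
        + cmod (zero_load_voltage Y $ i))"
      using L2_set_le_sum[of UNIV "\<lambda>i. cmod (v $ i)"] by (simp add: norm_vec_def)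
  qed
  ultimately show ?thesis
    by (simp add: compact_eq_bounded_closed)
qed

lemma convex_voltage_region: "convex (voltage_region Y s)"
proof -
  have "voltage_region Y s = (\<Inter>i. (\<lambda>v. v $ i) -`
      cball (zero_load_voltage Y $ i) (region_radius Y s * cmod (zero_load_voltage Y $ i)))"
    by (auto simp: mem_voltage_region_iff dist_norm norm_minus_commute)
  then show ?thesis
    by (auto intro!: convex_INT convex_linear_vimage bounded_linear.linear bounded_linear_vec_nth)
qed

section \<open>Invariance of the region and contraction on it\<close>

context
  fixes Y :: "complex ^ ('n::finite option) ^ ('n option)"
    and s :: "complex ^ 'n"
  assumes w_nonzero: "\<forall>j. zero_load_voltage Y $ j \<noteq> 0"
    and xi_less: "xi Y s < 1 / 4"
begin

text \<open>Supplies the nonemptiness required by Brouwer's theorem.\<close>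

lemma zero_load_voltage_in_region: "zero_load_voltage Y \<in> voltage_region Y s"
  using region_radius(1)[OF xi_less] by (simp add: mem_voltage_region_iff)

lemma voltage_region_cmod_ge:
  assumes "v \<in> voltage_region Y s"
  shows "(1 - region_radius Y s) * cmod (zero_load_voltage Y $ j) \<le> cmod (v $ j)"
proof -
  have "cmod (zero_load_voltage Y $ j - v $ j) \<le> region_radius Y s * cmod (zero_load_voltage Y $ j)"
    using assms by (simp add: mem_voltage_region_iff norm_minus_commute)
  with norm_triangle_sub[of "zero_load_voltage Y $ j" "v $ j"] show ?thesis
    by (simp add: left_diff_distrib)
qed

lemma voltage_region_nonzero:
  assumes "v \<in> voltage_region Y s"
  shows "\<forall>j. v $ j \<noteq> 0"
proof
  fix j
  have "0 < (1 - region_radius Y s) * cmod (zero_load_voltage Y $ j)"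
    using region_radius(2)[OF xi_less] w_nonzero by simp
  with voltage_region_cmod_ge[OF assms, of j] show "v $ j \<noteq> 0"
    by auto
qed

text \<open>Common core of two estimates: \<open>f j = 1 / cnj (v_j)\<close> gives invariance of the
  region, a difference of two such inverses gives the contraction.\<close>

lemma cmod_row_sum_le:
  assumes "\<And>j. cmod (f j) \<le> c / cmod (zero_load_voltage Y $ j)" and "0 \<le> c"
  shows "cmod (\<Sum>j\<in>UNIV. matrix_inv (Y_LL Y) $ i $ j * cnj (s $ j) * f j)
    \<le> c * xi Y s * cmod (zero_load_voltage Y $ i)"
proof -
  have "cmod (\<Sum>j\<in>UNIV. matrix_inv (Y_LL Y) $ i $ j * cnj (s $ j) * f j)
      \<le> (\<Sum>j\<in>UNIV. cmod (matrix_inv (Y_LL Y) $ i $ j * cnj (s $ j)) * (c / cmod (zero_load_voltage Y $ j)))"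
    by (rule sum_norm_le) (simp only: norm_mult, intro mult_left_mono assms, simp)
  also have "\<dots> = c * (\<Sum>j\<in>UNIV. cmod (matrix_inv (Y_LL Y) $ i $ j * cnj (s $ j)) / cmod (zero_load_voltage Y $ j))"
    by (simp add: sum_distrib_left mult_ac)
  also have "\<dots> \<le> c * (xi Y s * cmod (zero_load_voltage Y $ i))"
    by (intro mult_left_mono weighted_row_sum_le_xi w_nonzero assms(2))
  finally show ?thesis
    by (simp add: mult_ac)
qed

lemma load_flow_map_in_region:
  assumes "v \<in> voltage_region Y s"
  shows "load_flow_map Y s v \<in> voltage_region Y s"
  unfolding mem_voltage_region_iff
proof
  fix i
  define r where "r = region_radius Y s"
  have r: "0 \<le> r" "r < 1 / 2" "r * (1 - r) = xi Y s"
    using region_radius[OF xi_less] by (simp_all add: r_def)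
  have bound: "cmod (inverse (cnj (v $ j))) \<le> 1 / (1 - r) / cmod (zero_load_voltage Y $ j)" for j
  proof -
    have "0 < (1 - r) * cmod (zero_load_voltage Y $ j)"
      using w_nonzero r(2) by simp
    from le_imp_inverse_le[OF voltage_region_cmod_ge[OF assms, of j, folded r_def] this]
    show ?thesis
      by (simp add: norm_inverse divide_inverse)
  qed
  have "cmod (load_flow_map Y s v $ i - zero_load_voltage Y $ i)
      = cmod (\<Sum>j\<in>UNIV. matrix_inv (Y_LL Y) $ i $ j * cnj (s $ j) * inverse (cnj (v $ j)))"
    using voltage_region_nonzero[OF assms] by (simp add: load_flow_map_nth divide_inverse)
  also have "\<dots> \<le> 1 / (1 - r) * xi Y s * cmod (zero_load_voltage Y $ i)"
    using r by (intro cmod_row_sum_le bound) simp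
  \<comment> \<open>Here the choice of radius pays off: \<open>xi / (1 - r) = r\<close>.\<close>
  also have "\<dots> = r * cmod (zero_load_voltage Y $ i)"
    using r(2) by (simp flip: r(3))
  finally show "cmod (load_flow_map Y s v $ i - zero_load_voltage Y $ i)
      \<le> region_radius Y s * cmod (zero_load_voltage Y $ i)"
    by (simp add: r_def)
qed

text \<open>The number \<open>d\<close> is any bound on the distance of \<open>u\<close> and
  \<open>v\<close> in the maximum norm weighted by \<open>1 / |w_j|\<close>, so that norm need not
  be introduced as an object.\<close>

lemma load_flow_map_contraction:
  assumes "u \<in> voltage_region Y s" "v \<in> voltage_region Y s" "0 \<le> d"
    and "\<And>j. cmod (u $ j - v $ j) \<le> d * cmod (zero_load_voltage Y $ j)"
  shows "cmod (load_flow_map Y s u $ i - load_flow_map Y s v $ i)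
    \<le> region_radius Y s / (1 - region_radius Y s) * d * cmod (zero_load_voltage Y $ i)"
proof -
  define r where "r = region_radius Y s"
  have r: "r < 1 / 2" "r * (1 - r) = xi Y s"
    using region_radius[OF xi_less] by (simp_all add: r_def)
  have bound: "cmod (inverse (cnj (u $ j)) - inverse (cnj (v $ j)))
      \<le> d / (1 - r)\<^sup>2 / cmod (zero_load_voltage Y $ j)" for j
    using assms w_nonzero r
    by (intro cmod_diff_inverse_le) (auto simp: r_def voltage_region_cmod_ge simp flip: complex_cnj_diff)
  have "cmod (load_flow_map Y s u $ i - load_flow_map Y s v $ i)
      = cmod (\<Sum>j\<in>UNIV. matrix_inv (Y_LL Y) $ i $ j * cnj (s $ j) * (inverse (cnj (u $ j)) - inverse (cnj (v $ j))))"
    using assms voltage_region_nonzero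
    by (simp add: load_flow_map_nth divide_inverse right_diff_distrib sum_subtractf)
  also have "\<dots> \<le> d / (1 - r)\<^sup>2 * xi Y s * cmod (zero_load_voltage Y $ i)"
    using assms(3) by (intro cmod_row_sum_le bound) simp
  \<comment> \<open>Substituting \<open>xi = r (1 - r)\<close> cancels one factor
    \<open>1 - r\<close>.\<close>
  also have "d / (1 - r)\<^sup>2 * xi Y s = r / (1 - r) * d"
    using r(1) by (simp add: power2_eq_square flip: r(2))
  finally show ?thesis
    by (simp add: r_def)
qed

section \<open>Fixed point and convergence of the iteration\<close>

lemma continuous_on_load_flow_map: "continuous_on (voltage_region Y s) (load_flow_map Y s)"
proof -
  \<comment> \<open>Continuity is shown for the explicit formula, which agrees with the map on the
    region because no entry vanishes there.\<close>
  have "continuous_on (voltage_region Y s) (\<lambda>v. \<chi> i. zero_load_voltage Y $ i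
      + (\<Sum>j\<in>UNIV. matrix_inv (Y_LL Y) $ i $ j * cnj (s $ j) / cnj (v $ j)))"
    using voltage_region_nonzero by (intro continuous_intros) auto
  then show ?thesis
    by (rule continuous_on_eq) (simp add: vec_eq_iff load_flow_map_nth voltage_region_nonzero)
qed

text \<open>The contraction is in a weighted maximum norm while the metric of the vector type is
  Euclidean; Brouwer's theorem avoids a change of metric.\<close>

lemma load_flow_map_fixed_point_exists:
  "\<exists>v \<in> voltage_region Y s. load_flow_map Y s v = v"
proof -
  have "voltage_region Y s \<noteq> {}" "load_flow_map Y s \<in> voltage_region Y s \<rightarrow> voltage_region Y s"
    using zero_load_voltage_in_region by (blast, intro Pi_I load_flow_map_in_region)
  from brouwer[OF compact_voltage_region convex_voltage_region this(1) continuous_on_load_flow_map this(2)]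
  obtain v where "v \<in> voltage_region Y s" "load_flow_map Y s v = v" .
  then show ?thesis
    by blast
qed

lemma load_flow_iteration_in_region:
  assumes "x 0 \<in> voltage_region Y s" "\<forall>k. x (Suc k) = load_flow_map Y s (x k)"
  shows "x k \<in> voltage_region Y s"
  using assms by (induction k) (auto simp: load_flow_map_in_region)

lemma load_flow_iteration_tendsto:
  assumes v: "v \<in> voltage_region Y s" "v = load_flow_map Y s v"
    and x: "x 0 \<in> voltage_region Y s" "\<forall>k. x (Suc k) = load_flow_map Y s (x k)"
  shows "x \<longlonglongrightarrow> v"
proof -
  define r where "r = region_radius Y s"
  define c where "c = r / (1 - r)"
  have r: "0 \<le> r" "r < 1 / 2"
    using region_radius[OF xi_less] by (simp_all add: r_def)
  have c: "0 \<le> c" "c < 1"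
    using r by (simp_all add: c_def)
  \<comment> \<open>Two points of the region differ by at most \<open>2 r |w_i|\<close> in entry
    \<open>i\<close>, through the centre \<open>w\<close>; each iteration gains a factor
    \<open>c\<close>.\<close>
  have bound: "cmod (x k $ i - v $ i) \<le> c ^ k * (2 * r) * cmod (zero_load_voltage Y $ i)" for k i
  proof (induction k arbitrary: i)
    case 0
    have "cmod (x 0 $ i - v $ i) \<le> cmod (x 0 $ i - zero_load_voltage Y $ i) + cmod (v $ i - zero_load_voltage Y $ i)"
      by (metis dist_norm dist_triangle2)
    also have "\<dots> \<le> r * cmod (zero_load_voltage Y $ i) + r * cmod (zero_load_voltage Y $ i)"
      using v(1) x(1) by (intro add_mono) (auto simp: mem_voltage_region_iff r_def)
    finally show ?case
      by simp
  next
    case (Suc k)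
    \<comment> \<open>Contraction with \<open>d = c ^ k * (2 * r)\<close>; it needs the induction
      hypothesis for all entries at once, hence the generalization over \<open>i\<close>.\<close>
    have "cmod (load_flow_map Y s (x k) $ i - load_flow_map Y s v $ i)
        \<le> c * (c ^ k * (2 * r)) * cmod (zero_load_voltage Y $ i)"
      unfolding c_def r_def
      by (rule load_flow_map_contraction)
        (use Suc v(1) load_flow_iteration_in_region[of x, OF x] c r in \<open>auto simp: c_def r_def\<close>)
    then show ?case
      by (simp add: x(2) mult_ac flip: v(2))
  qed
  show ?thesis
  proof (rule vec_tendstoI)
    fix i
    have "(\<lambda>k. c ^ k * (2 * r) * cmod (zero_load_voltage Y $ i)) \<longlonglongrightarrow> 0"
      using c by (intro tendsto_mult_left_zero LIMSEQ_power_zero) simp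
    then have "(\<lambda>k. x k $ i - v $ i) \<longlonglongrightarrow> 0"
      by (rule Lim_null_comparison[rotated]) (simp add: bound)
    then show "(\<lambda>k. x k $ i) \<longlonglongrightarrow> v $ i"
      by (rule LIM_zero_cancel)
  qed
qed

text \<open>The constant sequence \<open>u\<close> is itself an iteration started in the region, so
  it converges to \<open>v\<close>.\<close>

lemma load_flow_map_fixed_point_unique:
  assumes "u \<in> voltage_region Y s" "u = load_flow_map Y s u"
    and "v \<in> voltage_region Y s" "v = load_flow_map Y s v"
  shows "u = v"
proof -
  have "(\<lambda>_ :: nat. u) \<longlonglongrightarrow> v"
    by (rule load_flow_iteration_tendsto[OF assms(3,4,1)]) (rule allI, rule assms(2))
  then show ?thesis
    by (simp add: LIMSEQ_const_iff)
qed

end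

theorem corollary1:
  fixes Y :: "complex ^ ('n::finite option) ^ ('n option)"
    and s :: "complex ^ 'n"
  assumes "invertible (Y_LL Y)"
    and "\<forall>j. zero_load_voltage Y $ j \<noteq> 0"
    and "xi Y s < 1 / 4"
  shows "(\<exists>!v. v \<in> voltage_region Y s \<and> load_flow_solution Y v s) \<and>
    (\<forall>v. v \<in> voltage_region Y s \<and> load_flow_solution Y v s \<longrightarrow>
      (\<forall>x :: nat \<Rightarrow> complex ^ 'n.
        x 0 \<in> voltage_region Y s \<and> (\<forall>k. x (Suc k) = load_flow_map Y s (x k)) \<longrightarrow>
          (\<forall>k j. x k $ j \<noteq> 0) \<and> x \<longlonglongrightarrow> v))"
proof (intro conjI allI impI; (elim conjE)?)
  obtain v where "v \<in> voltage_region Y s" "load_flow_map Y s v = v"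
    using load_flow_map_fixed_point_exists[OF assms(2,3)] by blast
  then have v: "v \<in> voltage_region Y s" "load_flow_solution Y v s"
    using voltage_region_nonzero[OF assms(2,3)] by (simp_all add: load_flow_solution_def)
  show "\<exists>!v. v \<in> voltage_region Y s \<and> load_flow_solution Y v s"
  proof (rule ex1I[of _ v])
    show "v \<in> voltage_region Y s \<and> load_flow_solution Y v s"
      using v by blast
    show "u = v" if "u \<in> voltage_region Y s \<and> load_flow_solution Y u s" for u
      using load_flow_map_fixed_point_unique[OF assms(2,3) _ load_flow_solution_fixed v(1)
          load_flow_solution_fixed[OF v(2)]] that by blast
  qed
next
  fix v and x :: "nat \<Rightarrow> complex ^ 'n"
  assume v: "v \<in> voltage_region Y s" "load_flow_solution Y v s"
    and x: "x 0 \<in> voltage_region Y s" "\<forall>k. x (Suc k) = load_flow_map Y s (x k)"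
  show "x \<longlonglongrightarrow> v"
    by (rule load_flow_iteration_tendsto[OF assms(2,3) v(1) load_flow_solution_fixed[OF v(2)] x])
  \<comment> \<open>The iteration never leaves the region, so every diagonal matrix inverted along
    the way is nonsingular.\<close>
  show "x k $ j \<noteq> 0" for k j
    by (rule voltage_region_nonzero[OF assms(2,3) load_flow_iteration_in_region[where x = x, OF assms(2,3) x], THEN spec])
qed

end
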